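(* Given $\kappa>0$, there exists $\delta>0$ such that $$\{c\in\mathcal M:\ |c+2|<\delta\}\cap \mathrm{Mis}_\kappa\subset\mathbb R.$$
   Context: For $c\in\mathbb C$, $f_c(z)=z^2+c$. $\mathcal M=\{c\in\mathbb C: (f_c^n(0))_n \text{ is bounded}\}$ is the Mandelbrot set. For $\kappa>0$, $\mathrm{Mis}_\kappa=\{c\in\mathcal M:\ |f_c^n(c)|\ge\kappa \text{ for all } n\ge 1\}$. *)

theory Defs
  imports "HOL-Analysis.Analysis"
begin

definition quad :: "complex \<Rightarrow> complex \<Rightarrow> complex"
  where "quad c z = z\<^sup>2 + c"

definition mandelbrot :: "complex set"
  where "mandelbrot = {c. bounded (range (\<lambda>n. (quad c ^^ n) 0))}"

text \<open>The orbit below starts at the critical value \<open>c\<close>, and its initial point is exempt: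
  the condition is on \<open>c\<^sup>2 + c\<close> and its iterates.\<close>

definition Mis :: "real \<Rightarrow> complex set"
  where "Mis \<kappa> = {c \<in> mandelbrot. \<forall>n\<ge>1. \<kappa> \<le> cmod ((quad c ^^ n) c)}"

end

theory Submission
  imports Defs
begin

text \<open>
  Write \<open>z\<^sub>n\<close> for the orbit of \<open>c\<close>, with \<open>x\<^sub>n = Re z\<^sub>n\<close>, \<open>y\<^sub>n = Im z\<^sub>n\<close> and \<open>v = Im c\<close>. The imaginary
  part of \<open>z\<^sub>n\<^sub>+\<^sub>1 = z\<^sub>n\<^sup>2 + c\<close> is the affine recursion \<open>y\<^sub>n\<^sub>+\<^sub>1 = 2 x\<^sub>n y\<^sub>n + v\<close> with \<open>y\<^sub>0 = v\<close>, so that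
  with \<open>P\<^sub>n = 2x\<^sub>0 \<sqdot> \<dots> \<sqdot> 2x\<^sub>n\<^sub>-\<^sub>1\<close>
  \[ y_n = v P_n (1 + 1/P_1 + \dots + 1/P_n). \]
  If \<open>P\<^sub>n\<close> grows exponentially and the bracket stays away from \<open>0\<close>, then boundedness of the orbit
  forces \<open>v = 0\<close>, which is the claim. At \<open>c = -2\<close> the orbit is \<open>-2, 2, 2, \<dots>\<close> and the bracket tends to
  \<open>1 - 1/4 - 1/16 - \<dots> = 2/3\<close>; this nonvanishing is the transversality of the critical value to
  the moving hyperbolic set. Three estimates make the argument uniform in \<open>c\<close> near \<open>-2\<close>.

  The filled Julia set lies near \<open>[-2, 2]\<close>. The half-sum \<open>t\<close> of the distances to the foci \<open>\<plusminus>2\<close>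
  satisfies \<open>t(z\<^sup>2 - 2) = t(z)\<^sup>2 - 2\<close> exactly, so a bounded orbit has \<open>t \<le> 2 + |c + 2|/3\<close>
  (\<open>bounded_chebyshev_sequence_le\<close>). This makes \<open>y\<^sub>n\<^sup>2\<close> at most of order \<open>|c + 2|\<close>
  (\<open>mandelbrot_orbit_near_segment\<close>), and \<open>x\<^sub>n\<close> is a pseudo-orbit of \<open>x \<mapsto> x\<^sup>2 - 2\<close>.

  This pseudo-orbit is uniformly expanding. The map \<open>x \<mapsto> x\<^sup>2 - 2\<close> doubles lengths in the metric
  \<open>dx / sqrt (4 - x\<^sup>2)\<close>; replacing \<open>4\<close> by a slightly larger constant tolerates the perturbation,
  and as \<open>x\<^sub>n\<close> is bounded away from \<open>0\<close> the expansion remains at least \<open>3/2\<close>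
  (\<open>perturbed_metric_expansion\<close>). So \<open>|P\<^sub>n| \<ge> (9/10) (3/2)\<^sup>n\<close>, with a constant independent of \<open>\<kappa>\<close>
  (\<open>multiplier_product_lower_bound\<close>).

  The first five factors have modulus at least \<open>3\<close> because the orbit starts close to \<open>-2, 2, 2, \<dots>\<close>;
  together with the exponential bound on the rest, this keeps the bracket at modulus at least \<open>1/5\<close>
  (\<open>affine_recursion_growth\<close>).
\<close>

section \<open>Bounded orbits stay near the segment from -2 to 2\<close>

text \<open>The level sets are the ellipses with foci \<open>\<plusminus>2\<close>, on which \<open>z\<^sup>2 - 2\<close> acts as a Chebyshev map.\<close>

definition semimajor :: "complex \<Rightarrow> real"
  where "semimajor z = (cmod (z - 2) + cmod (z + 2)) / 2"

lemma semimajor_square: "(semimajor z)\<^sup>2 = ((cmod z)\<^sup>2 + cmod (z\<^sup>2 - 4)) / 2 + 2"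
proof -
  have par: "(cmod (z - 2))\<^sup>2 + (cmod (z + 2))\<^sup>2 = 2 * (cmod z)\<^sup>2 + 8"
    unfolding cmod_power2 by (simp add: power2_eq_square algebra_simps)
  have "cmod (z - 2) * cmod (z + 2) = cmod (z\<^sup>2 - 4)"
    by (simp add: norm_mult [symmetric] power2_eq_square algebra_simps)
  with par show ?thesis
    unfolding semimajor_def by (simp add: power2_eq_square field_simps)
qed

text \<open>The parallelogram law turns \<open>t\<^sup>2\<close> into a sum of distances from \<open>z\<^sup>2 - 2\<close> to \<open>\<plusminus>2\<close>; moving the
  point by \<open>c + 2\<close> then costs at most \<open>|c + 2|\<close>.\<close>

lemma semimajor_quad: "(semimajor z)\<^sup>2 - 2 - cmod (c + 2) \<le> semimajor (quad c z)"
proof -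
  have "cmod (z\<^sup>2 - 4) \<le> cmod (quad c z - 2) + cmod (c + 2)"
    using norm_triangle_ineq4 [of "quad c z - 2" "c + 2"] by (simp add: quad_def)
  moreover have "cmod (z\<^sup>2) \<le> cmod (quad c z + 2) + cmod (c + 2)"
    using norm_triangle_ineq4 [of "quad c z + 2" "c + 2"] by (simp add: quad_def)
  ultimately show ?thesis
    unfolding semimajor_square unfolding semimajor_def norm_power by argo
qed

lemma semimajor_ge_2: "2 \<le> semimajor z"
  using norm_triangle_ineq4 [of "z + 2" "z - 2"] by (simp add: semimajor_def)

lemma semimajor_le: "semimajor z \<le> cmod z + 2"
  using norm_triangle_ineq [of z 2] norm_triangle_ineq4 [of z 2] by (simp add: semimajor_def)

lemma Im_square_le_semimajor: "(Im z)\<^sup>2 \<le> (semimajor z)\<^sup>2 - 4"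
proof -
  have "- Re (z\<^sup>2 - 4) \<le> cmod (z\<^sup>2 - 4)"
    using abs_Re_le_cmod [of "z\<^sup>2 - 4"] by linarith
  moreover have "Re (z\<^sup>2 - 4) = (Re z)\<^sup>2 - (Im z)\<^sup>2 - 4"
    by (simp add: power2_eq_square)
  ultimately show ?thesis
    unfolding semimajor_square cmod_power2 by argo
qed

lemma Re_square_le_semimajor: "(Re z)\<^sup>2 \<le> (semimajor z)\<^sup>2"
proof -
  have "Re (z\<^sup>2 - 4) \<le> cmod (z\<^sup>2 - 4)"
    using abs_Re_le_cmod [of "z\<^sup>2 - 4"] by linarith
  moreover have "Re (z\<^sup>2 - 4) = (Re z)\<^sup>2 - (Im z)\<^sup>2 - 4"
    by (simp add: power2_eq_square)
  ultimately show ?thesis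
    unfolding semimajor_square cmod_power2 by argo
qed

text \<open>The excess of \<open>t\<close> over \<open>2 + d/3\<close>, once positive, at least quadruples at every step.\<close>

lemma bounded_chebyshev_sequence_le:
  fixes t :: "nat \<Rightarrow> real"
  assumes rec: "\<And>n. (t n)\<^sup>2 - 2 - d \<le> t (Suc n)"
    and ge: "\<And>n. 2 \<le> t n" and bd: "\<And>n. t n \<le> B"
  shows "t n \<le> 2 + d / 3"
proof (rule ccontr)
  define u where "u = t n - 2 - d / 3"
  assume "\<not> t n \<le> 2 + d / 3"
  then have u: "u > 0" by (simp add: u_def)
  have grow: "4 ^ m * u \<le> t (n + m) - 2 - d / 3" for m
  proof (induction m)
    case 0
    show ?case by (simp add: u_def)
  next
    case (Suc m)
    have "4 * (t (n + m) - 2) \<le> (t (n + m) + 2) * (t (n + m) - 2)"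
      using ge [of "n + m"] by (intro mult_right_mono) auto
    also have "\<dots> = (t (n + m))\<^sup>2 - 4"
      by (simp add: power2_eq_square algebra_simps)
    finally show ?case
      using rec [of "n + m"] Suc.IH by simp
  qed
  obtain m where "(B - 2 - d / 3) / u < 4 ^ m"
    using real_arch_pow [of 4] by auto
  then have "B - 2 - d / 3 < 4 ^ m * u"
    using u by (simp add: divide_less_eq)
  with grow [of m] bd [of "n + m"] show False by linarith
qed

lemma mandelbrot_orbit_near_segment:
  assumes c: "c \<in> mandelbrot" and d: "cmod (c + 2) \<le> d" "d \<le> 6"
  shows "(Re ((quad c ^^ n) c))\<^sup>2 \<le> 4 + 2 * d" "(Im ((quad c ^^ n) c))\<^sup>2 \<le> 2 * d"
proof -
  define z where "z n = (quad c ^^ n) c" for n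
  have d0: "0 \<le> d" using d(1) norm_ge_zero order_trans by blast
  obtain B where B: "\<And>n. cmod ((quad c ^^ n) 0) \<le> B"
    using c unfolding mandelbrot_def bounded_iff by auto
  have "z n = (quad c ^^ Suc n) 0" for n
    unfolding z_def funpow_Suc_right by (simp add: quad_def)
  then have zB: "cmod (z n) \<le> B" for n
    using B by metis
  have "semimajor (z n) \<le> 2 + d / 3"
  proof (rule bounded_chebyshev_sequence_le [where t = "\<lambda>n. semimajor (z n)" and B = "B + 2"])
    fix n
    have "z (Suc n) = quad c (z n)" by (simp add: z_def)
    with semimajor_quad [of "z n" c] d(1)
    show "(semimajor (z n))\<^sup>2 - 2 - d \<le> semimajor (z (Suc n))" by simp
    show "2 \<le> semimajor (z n)" by (rule semimajor_ge_2)
    show "semimajor (z n) \<le> B + 2" using semimajor_le [of "z n"] zB [of n] by linarith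
  qed
  then have "(semimajor (z n))\<^sup>2 \<le> (2 + d / 3)\<^sup>2"
    using semimajor_ge_2 [of "z n"] by (intro power_mono) auto
  also have "\<dots> \<le> 4 + 2 * d"
    using mult_mono [of d 6 d d] d(2) d0 by (simp add: power2_eq_square algebra_simps)
  finally have "(semimajor (z n))\<^sup>2 \<le> 4 + 2 * d" .
  then show "(Re ((quad c ^^ n) c))\<^sup>2 \<le> 4 + 2 * d" "(Im ((quad c ^^ n) c))\<^sup>2 \<le> 2 * d"
    using Re_square_le_semimajor [of "z n"] Im_square_le_semimajor [of "z n"]
    by (simp_all add: z_def)
qed

section \<open>Expansion along pseudo-orbits of the Chebyshev map\<close>

text \<open>Squared derivative of \<open>x \<mapsto> x\<^sup>2 - 2 + e\<close> measured in the metric \<open>dx / sqrt (4 + 40 d - x\<^sup>2)\<close>.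
  Without perturbation (\<open>d = e = 0\<close>) the two sides would be \<open>9/4\<close> and \<open>4\<close> times \<open>x\<^sup>2 (4 - x\<^sup>2)\<close>.
  The surplus \<open>(7/4) x\<^sup>2 (4 - x\<^sup>2)\<close> absorbs the error when \<open>x\<^sup>2 \<le> 1\<close>, thanks to \<open>k \<le> x\<^sup>2\<close>. Near
  \<open>x = \<plusminus>2\<close> it degenerates, and there the \<open>40 d\<close> term, which enters with the factor
  \<open>4 x\<^sup>2 - 9/4 > 0\<close>, takes over; \<open>40\<close> is large enough to dominate the contributions of
  \<open>x\<^sup>2 - 4 \<le> 2 d\<close> and \<open>|e| \<le> 3 d\<close>.\<close>

lemma perturbed_metric_expansion:
  fixes x e d k :: real
  assumes d: "0 \<le> d" "d \<le> 1 / 2" "23 * d \<le> k"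
    and x: "k \<le> x\<^sup>2" "x\<^sup>2 \<le> 4 + 2 * d" and e: "\<bar>e\<bar> \<le> 3 * d"
  shows "9 / 4 * (4 + 40 * d - (x\<^sup>2 - 2 + e)\<^sup>2) \<le> 4 * x\<^sup>2 * (4 + 40 * d - x\<^sup>2)"
proof -
  define u where "u = x\<^sup>2"
  have u: "k \<le> u" "0 \<le> u" "u \<le> 4 + 2 * d" using x by (auto simp: u_def)
  have eq: "4 * u * (4 + 40 * d - u) - 9 / 4 * (4 + 40 * d - (u - 2 + e)\<^sup>2)
      = 7 / 4 * (u * (4 - u)) + 40 * d * (4 * u - 9 / 4) + 9 / 4 * (2 * (e * (u - 2)) + e\<^sup>2)"
    by (simp add: power2_eq_square field_simps)
  have "0 \<le> 7 / 4 * (u * (4 - u)) + 40 * d * (4 * u - 9 / 4) + 9 / 4 * (2 * (e * (u - 2)) + e\<^sup>2)"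
  proof (cases "u \<le> 1")
    case True
    have "\<bar>e * (u - 2)\<bar> \<le> 3 * d * 2"
      unfolding abs_mult using e u True d by (intro mult_mono) auto
    moreover have "k * 3 \<le> u * (4 - u)"
      using u True d by (intro mult_mono) auto
    moreover have "40 * d * (- 9 / 4) \<le> 40 * d * (4 * u - 9 / 4)"
      using u d by (intro mult_left_mono) auto
    moreover have "0 \<le> e\<^sup>2" by simp
    ultimately show ?thesis unfolding abs_le_iff using d by argo
  next
    case False
    have "\<bar>e * (u - 2)\<bar> \<le> 3 * d * 3"
      unfolding abs_mult using e u False d by (intro mult_mono) auto
    moreover have "- (10 * d) \<le> u * (4 - u)"
    proof (cases "u \<le> 4")
      case True
      then have "0 \<le> u * (4 - u)" using u by simp
      then show ?thesis using d by linarith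
    next
      case False
      have "u * (u - 4) \<le> 5 * (2 * d)"
        using u d False by (intro mult_mono) auto
      then show ?thesis by (simp add: algebra_simps)
    qed
    moreover have "40 * d * (7 / 4) \<le> 40 * d * (4 * u - 9 / 4)"
      using False d by (intro mult_left_mono) auto
    moreover have "0 \<le> e\<^sup>2" by simp
    ultimately show ?thesis unfolding abs_le_iff using d by argo
  qed
  with eq show ?thesis unfolding u_def by linarith
qed

text \<open>The one-step expansion telescopes. The initial and final values of \<open>4 + 40 d - x\<^sup>2\<close> are at most
  \<open>44 d\<close> and at least \<open>38 d\<close>, so that their ratio costs only the constant \<open>9/10 < sqrt (38/44)\<close>,
  whatever \<open>d\<close>.\<close>

lemma multiplier_product_lower_bound:
  fixes x :: "nat \<Rightarrow> real"
  assumes d: "0 < d" "d \<le> 1 / 2" "23 * d \<le> k"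
    and x: "\<And>n. k \<le> (x n)\<^sup>2" "\<And>n. (x n)\<^sup>2 \<le> 4 + 2 * d"
    and start: "2 - d \<le> \<bar>x 0\<bar>"
    and rec: "\<And>n. \<bar>x (Suc n) - ((x n)\<^sup>2 - 2)\<bar> \<le> 3 * d"
  shows "9 / 10 * (3 / 2) ^ n \<le> \<bar>\<Prod>i<n. 2 * x i\<bar>"
proof -
  define P where "P n = (\<Prod>i<n. 2 * x i)" for n
  define w where "w n = 4 + 40 * d - (x n)\<^sup>2" for n
  have tele: "(9 / 4) ^ n * w n \<le> (P n)\<^sup>2 * w 0" for n
  proof (induction n)
    case 0
    show ?case by (simp add: P_def)
  next
    case (Suc n)
    have step: "9 / 4 * w (Suc n) \<le> 4 * (x n)\<^sup>2 * w n"
      using perturbed_metric_expansion [OF _ d(2,3) x(1) x(2) rec, of n n] d(1)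
      by (simp add: w_def)
    have "(9 / 4) ^ Suc n * w (Suc n) = (9 / 4) ^ n * (9 / 4 * w (Suc n))"
      by simp
    also have "\<dots> \<le> (9 / 4) ^ n * (4 * (x n)\<^sup>2 * w n)"
      by (rule mult_left_mono [OF step]) simp
    also have "\<dots> = 4 * (x n)\<^sup>2 * ((9 / 4) ^ n * w n)"
      by simp
    also have "\<dots> \<le> 4 * (x n)\<^sup>2 * ((P n)\<^sup>2 * w 0)"
      by (rule mult_left_mono [OF Suc.IH]) simp
    also have "\<dots> = (P (Suc n))\<^sup>2 * w 0"
      by (simp add: P_def power2_eq_square)
    finally show ?case .
  qed
  have "(2 - d)\<^sup>2 \<le> \<bar>x 0\<bar>\<^sup>2"
    using start d by (intro power_mono) auto
  moreover have "4 - 4 * d \<le> (2 - d)\<^sup>2"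
    by (simp add: power2_eq_square algebra_simps)
  ultimately have w0: "w 0 \<le> 44 * d" by (simp add: w_def)
  have wn: "38 * d \<le> w n" using x(2) [of n] by (simp add: w_def)
  have "(9 / 4) ^ n * (38 * d) \<le> (9 / 4) ^ n * w n"
    by (rule mult_left_mono [OF wn]) simp
  also have "\<dots> \<le> (P n)\<^sup>2 * w 0" by (rule tele)
  also have "\<dots> \<le> (P n)\<^sup>2 * (44 * d)" by (rule mult_left_mono [OF w0]) simp
  finally have "d * (38 * (9 / 4) ^ n) \<le> d * (44 * (P n)\<^sup>2)" by (simp add: algebra_simps)
  then have "38 * (9 / 4) ^ n \<le> 44 * (P n)\<^sup>2" using d(1) by simp
  then have "81 / 100 * (9 / 4) ^ n \<le> (P n)\<^sup>2"
    using zero_le_power [of "9 / 4 :: real" n] by linarith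
  moreover have "(9 / 10 * (3 / 2) ^ n)\<^sup>2 = 81 / 100 * (9 / 4 :: real) ^ n"
    unfolding power_mult_distrib power_even_eq [symmetric] power_mult
    by (simp add: power2_eq_square power_mult_distrib [symmetric])
  ultimately have "(9 / 10 * (3 / 2) ^ n)\<^sup>2 \<le> \<bar>P n\<bar>\<^sup>2" by simp
  then show ?thesis
    unfolding P_def by (rule power2_le_imp_le) simp
qed

text \<open>Near the repelling fixed point \<open>2\<close> errors multiply by at most \<open>4\<close> per step; \<open>(2 \<sqdot> 4\<^sup>n - 1) d\<close>
  solves \<open>m \<mapsto> 4 m + 3 d\<close> with initial value \<open>d\<close>.\<close>

lemma initial_segment_near_2:
  fixes x :: "nat \<Rightarrow> real"
  assumes d: "0 \<le> d" "d \<le> 1 / 1024"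
    and start: "2 - d \<le> \<bar>x 0\<bar>"
    and rec: "\<And>n. \<bar>x (Suc n) - ((x n)\<^sup>2 - 2)\<bar> \<le> 3 * d"
    and n: "n < 5"
  shows "3 / 2 \<le> \<bar>x n\<bar>"
proof -
  define m where "m n = (2 * 4 ^ n - 1) * d" for n :: nat
  have small: "m n \<le> 1 / 2" if "n < 5" for n
  proof -
    have "(4 :: real) ^ n \<le> 4 ^ 4" using that by (intro power_increasing) auto
    then have "m n \<le> 511 * d"
      unfolding m_def using d(1) by (intro mult_right_mono) auto
    then show ?thesis using d(2) by linarith
  qed
  have "2 - m n \<le> \<bar>x n\<bar>" if "n < 5" for n
    using that
  proof (induction n)
    case 0
    show ?case using start by (simp add: m_def)
  next
    case (Suc n)
    have "(2 - m n)\<^sup>2 \<le> \<bar>x n\<bar>\<^sup>2"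
      using Suc small [of n] by (intro power_mono) auto
    moreover have "4 - 4 * m n \<le> (2 - m n)\<^sup>2"
      by (simp add: power2_eq_square algebra_simps)
    moreover have "m (Suc n) = 4 * m n + 3 * d"
      by (simp add: m_def algebra_simps)
    ultimately show ?case using rec [of n] by simp
  qed
  with n small [of n] show ?thesis by fastforce
qed

section \<open>Growth of the imaginary parts\<close>

text \<open>With \<open>P\<^sub>n\<close> the product of the \<open>2 x\<^sub>i\<close> for \<open>i < n\<close>, the quotient \<open>y\<^sub>n / (v P\<^sub>n)\<close> is
  \<open>1 + 1/P\<^sub>1 + \<dots> + 1/P\<^sub>n\<close>. Five factors of modulus at least \<open>3\<close> keep its modulus above
  \<open>1 - 1/3 - \<dots> - 1/3\<^sup>5 > 1/2\<close> up to \<open>n = 5\<close>; the rest of the series is dominated by the tail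
  of a geometric series of ratio \<open>2/3\<close>, whose sum is below \<open>3/10\<close>.\<close>

lemma affine_recursion_growth:
  fixes x y :: "nat \<Rightarrow> real"
  assumes y0: "y 0 = v" and rec: "\<And>n. y (Suc n) = 2 * x n * y n + v"
    and first: "\<And>n. n < 5 \<Longrightarrow> 3 / 2 \<le> \<bar>x n\<bar>"
    and prod: "\<And>n. 9 / 10 * (3 / 2) ^ n \<le> \<bar>\<Prod>i<n. 2 * x i\<bar>"
    and n: "5 \<le> n"
  shows "\<bar>v\<bar> * \<bar>\<Prod>i<n. 2 * x i\<bar> / 5 \<le> \<bar>y n\<bar>"
proof -
  define P where "P n = (\<Prod>i<n. 2 * x i)" for n
  \<comment> \<open>A lower bound \<open>a\<close> for the modulus of the quotient drops to \<open>b\<close> if the new term \<open>1/P\<^sub>n\<^sub>+\<^sub>1\<close> has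
    modulus at most \<open>a - b\<close>; phrased without division, so that \<open>v = 0\<close> is covered.\<close>
  have absorb: "\<bar>v\<bar> * \<bar>P (Suc n)\<bar> * b \<le> \<bar>y (Suc n)\<bar>"
    if IH: "\<bar>v\<bar> * \<bar>P n\<bar> * a \<le> \<bar>y n\<bar>" and gap: "1 \<le> \<bar>P (Suc n)\<bar> * (a - b)" for n a b
  proof -
    have "\<bar>v\<bar> * \<bar>P (Suc n)\<bar> * b = \<bar>2 * x n\<bar> * (\<bar>v\<bar> * \<bar>P n\<bar> * a) - \<bar>v\<bar> * (\<bar>P (Suc n)\<bar> * (a - b))"
      by (simp add: P_def abs_mult algebra_simps)
    also have "\<dots> \<le> \<bar>2 * x n\<bar> * \<bar>y n\<bar> - \<bar>v\<bar> * 1"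
      by (intro diff_mono mult_left_mono IH gap) auto
    also have "\<dots> \<le> \<bar>y (Suc n)\<bar>"
      unfolding rec by (simp add: abs_mult [symmetric])
    finally show ?thesis .
  qed
  have P3: "3 ^ n \<le> \<bar>P n\<bar>" if "n \<le> 5" for n
    using that
  proof (induction n)
    case 0
    show ?case by (simp add: P_def)
  next
    case (Suc n)
    have "3 ^ n * 3 \<le> \<bar>P n\<bar> * \<bar>2 * x n\<bar>"
      using Suc first [of n] by (intro mult_mono) auto
    then show ?case by (simp add: P_def abs_mult mult.commute)
  qed
  have "\<bar>v\<bar> * \<bar>P n\<bar> * (1 / 2 + 1 / 2 * (1 / 3) ^ n) \<le> \<bar>y n\<bar>" if "n \<le> 5" for n
    using that
  proof (induction n)
    case 0
    show ?case by (simp add: P_def y0)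
  next
    case (Suc n)
    have "3 ^ Suc n * (1 / 3) ^ Suc n \<le> \<bar>P (Suc n)\<bar> * (1 / 3) ^ Suc n"
      using P3 [OF Suc.prems] by (rule mult_right_mono) simp
    then have gap: "1 \<le> \<bar>P (Suc n)\<bar> * (1 / 3) ^ Suc n"
      by (simp add: power_mult_distrib [symmetric] del: power_Suc)
    show ?case
      by (rule absorb [OF Suc.IH]) (use Suc.prems gap in \<open>simp_all add: field_simps\<close>)
  qed
  from this [of 5] have five: "\<bar>v\<bar> * \<bar>P 5\<bar> * (1 / 2 + 1 / 2 * (1 / 3) ^ 5) \<le> \<bar>y 5\<bar>" by simp
  have "\<bar>v\<bar> * \<bar>P n\<bar> * (1 / 5 + 20 / 9 * (2 / 3) ^ n) \<le> \<bar>y n\<bar>"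
    using n
  proof (induction n rule: dec_induct)
    case base
    have "\<bar>v\<bar> * \<bar>P 5\<bar> * (1 / 5 + 20 / 9 * (2 / 3) ^ 5) \<le> \<bar>v\<bar> * \<bar>P 5\<bar> * (1 / 2 + 1 / 2 * (1 / 3) ^ 5)"
      by (intro mult_left_mono) (auto simp: eval_nat_numeral)
    with five show ?case by linarith
  next
    case (step n)
    have "9 / 10 * (3 / 2) ^ Suc n * (10 / 9 * (2 / 3) ^ Suc n)
        \<le> \<bar>P (Suc n)\<bar> * (10 / 9 * (2 / 3) ^ Suc n)"
      using prod [of "Suc n"] unfolding P_def by (rule mult_right_mono) simp
    moreover have "9 / 10 * (3 / 2) ^ Suc n * (10 / 9 * (2 / 3) ^ Suc n) = (1 :: real)"
      by (simp add: power_mult_distrib [symmetric] del: power_Suc)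
    ultimately have gap: "1 \<le> \<bar>P (Suc n)\<bar> * (10 / 9 * (2 / 3) ^ Suc n)" by linarith
    show ?case
      by (rule absorb [OF step.IH]) (use gap in \<open>simp add: field_simps\<close>)
  qed
  moreover have "\<bar>v\<bar> * \<bar>P n\<bar> * (1 / 5) \<le> \<bar>v\<bar> * \<bar>P n\<bar> * (1 / 5 + 20 / 9 * (2 / 3) ^ n)"
    by (intro mult_left_mono) auto
  ultimately show ?thesis unfolding P_def [symmetric] by linarith
qed

section \<open>Parameters near -2 with orbit avoiding the critical point are real\<close>

theorem proposition1p1:
  fixes \<kappa> :: real
  assumes "\<kappa> > 0"
  shows "\<exists>\<delta>>0. {c \<in> mandelbrot. cmod (c + 2) < \<delta>} \<inter> Mis \<kappa> \<subseteq> \<real>"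
proof -
  \<comment> \<open>Since \<open>x\<^sub>n\<^sup>2 = |z\<^sub>n|\<^sup>2 - y\<^sub>n\<^sup>2 \<ge> \<kappa>\<^sup>2 - 2 d\<close>, the bound \<open>25 d \<le> \<kappa>\<^sup>2\<close> leaves \<open>x\<^sub>n\<^sup>2 \<ge> 23 d\<close>, which is
    what the expansion estimate asks for.\<close>
  define d where "d = min (1 / 1024) (\<kappa>\<^sup>2 / 25)"
  have d: "0 < d" "d \<le> 1 / 1024" "25 * d \<le> \<kappa>\<^sup>2"
    using assms by (auto simp: d_def)
  have "c \<in> \<real>" if M: "c \<in> mandelbrot" and near: "cmod (c + 2) < d" and mis: "c \<in> Mis \<kappa>" for c
  proof -
    define x where "x n = Re ((quad c ^^ n) c)" for n
    define y where "y n = Im ((quad c ^^ n) c)" for n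
    have xle: "(x n)\<^sup>2 \<le> 4 + 2 * d" and yle: "(y n)\<^sup>2 \<le> 2 * d" for n
      using mandelbrot_orbit_near_segment [OF M, of d n] near d by (auto simp: x_def y_def)
    have a: "\<bar>Re c + 2\<bar> < d"
      using abs_Re_le_cmod [of "c + 2"] near by simp
    have start: "2 - d \<le> \<bar>x 0\<bar>" using a by (simp add: x_def)
    have xrec: "\<bar>x (Suc n) - ((x n)\<^sup>2 - 2)\<bar> \<le> 3 * d" for n
    proof -
      have "x (Suc n) - ((x n)\<^sup>2 - 2) = Re c + 2 - (y n)\<^sup>2"
        by (simp add: x_def y_def quad_def power2_eq_square)
      then show ?thesis using a yle [of n] zero_le_power2 [of "y n"] by linarith
    qed
    have yrec: "y (Suc n) = 2 * x n * y n + Im c" for n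
      by (simp add: x_def y_def quad_def power2_eq_square)
    \<comment> \<open>\<open>Mis\<close> says nothing about \<open>z\<^sub>0 = c\<close>, but \<open>c\<close> is close to \<open>-2\<close>.\<close>
    have xge: "23 * d \<le> (x n)\<^sup>2" for n
    proof (cases "n = 0")
      case True
      have "(3 / 2)\<^sup>2 \<le> \<bar>x 0\<bar>\<^sup>2" using start d by (intro power_mono) auto
      then show ?thesis using True d by (simp add: power2_eq_square)
    next
      case False
      then have "\<kappa>\<^sup>2 \<le> (cmod ((quad c ^^ n) c))\<^sup>2"
        using mis assms by (intro power_mono) (auto simp: Mis_def)
      also have "\<dots> = (x n)\<^sup>2 + (y n)\<^sup>2" by (simp add: x_def y_def cmod_power2)
      finally show ?thesis using yle [of n] d(3) by linarith
    qed
    have prod: "9 / 10 * (3 / 2) ^ n \<le> \<bar>\<Prod>i<n. 2 * x i\<bar>" for n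
      using multiplier_product_lower_bound [OF d(1) _ order_refl xge xle start xrec] d(2) by simp
    have first: "3 / 2 \<le> \<bar>x n\<bar>" if "n < 5" for n
      using initial_segment_near_2 [OF _ d(2) start xrec that] d(1) by simp
    have y0: "y 0 = Im c" by (simp add: y_def)
    have "\<bar>y n\<bar> \<le> 1" for n
      using yle [of n] d(2) by (intro abs_square_le_1 [THEN iffD1]) linarith
    then have bound: "\<bar>Im c\<bar> * (9 / 10 * (3 / 2) ^ n) / 5 \<le> 1" if "5 \<le> n" for n
      using affine_recursion_growth [OF y0 yrec first prod that]
        mult_left_mono [OF prod [of n], of "\<bar>Im c\<bar>"] by (smt (verit) divide_right_mono abs_ge_zero)
    have "Im c = 0"
    proof (rule ccontr)
      assume v: "Im c \<noteq> 0"
      obtain N where N: "50 / (9 * \<bar>Im c\<bar>) < (3 / 2 :: real) ^ N"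
        using real_arch_pow [of "3 / 2"] by auto
      also have "\<dots> \<le> (3 / 2) ^ (N + 5)" by (intro power_increasing) auto
      finally have "50 / (9 * \<bar>Im c\<bar>) < (3 / 2) ^ (N + 5)" .
      then have "50 < 9 * \<bar>Im c\<bar> * (3 / 2) ^ (N + 5)"
        using v by (simp add: pos_divide_less_eq mult.commute)
      with bound [of "N + 5"] show False by (simp del: power_add)
    qed
    then show "c \<in> \<real>" by (simp add: complex_is_Real_iff)
  qed
  with d(1) show ?thesis by (intro exI [of _ d]) auto
qed

end
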